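(* For all positive integers $n,m$, the $(n\times m)$-King's graph $G$ satisfies $\mathrm{tww}(G)\le 7$.
   Context: The $(n\times m)$-King's graph has vertex set $\{1,\dots,n\}\times\{1,\dots,m\}$, with distinct vertices $(i,j),(i',j')$ adjacent iff $|i-i'|\le 1$ and $|j-j'|\le 1$ (equivalently, it is the strong product of the paths $P_n$ and $P_m$). Twin-width: a trigraph is a vertex set with two disjoint sets of edges, black and red. Contracting two distinct vertices $u,v$ replaces them by a new vertex $w$; each $x\ne u,v$ adjacent to exactly one of $u,v$ is joined to $w$ by a red edge; each $x$ adjacent to both is joined to $w$ by a black edge if $ux,vx$ are both black and by a red edge otherwise; other edges are unchanged. A simple graph is a trigraph with no red edges. A $d$-sequence for an $N$-vertex graph $G$ is a sequence $G=G_N,\dots,G_1$ of trigraphs, each obtained from the previous by one contraction, with every vertex of every $G_i$ incident to at most $d$ red edges; $\mathrm{tww}(G)$ is the least such $d$. *)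

theory Defs
  imports Main
begin

text \<open>Edges are two-element sets of vertices.\<close>

record 'a trigraph =
  verts :: "'a set"
  black :: "'a set set"
  red :: "'a set set"

definition trigraph :: "'a trigraph \<Rightarrow> bool" where
  "trigraph T \<longleftrightarrow>
     finite (verts T) \<and>
     black T \<union> red T \<subseteq> {{x, y} | x y. x \<in> verts T \<and> y \<in> verts T \<and> x \<noteq> y} \<and>
     black T \<inter> red T = {}"

definition adj :: "'a trigraph \<Rightarrow> 'a \<Rightarrow> 'a \<Rightarrow> bool" where
  "adj T x y \<longleftrightarrow> {x, y} \<in> black T \<union> red T"

definition contract :: "'a \<Rightarrow> 'a \<Rightarrow> 'a \<Rightarrow> 'a trigraph \<Rightarrow> 'a trigraph" where
  "contract u v w T =
    \<lparr> verts = insert w (verts T - {u, v}),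
      black = {e \<in> black T. u \<notin> e \<and> v \<notin> e}
        \<union> {{w, x} | x. x \<in> verts T - {u, v} \<and> {u, x} \<in> black T \<and> {v, x} \<in> black T},
      red = {e \<in> red T. u \<notin> e \<and> v \<notin> e}
        \<union> {{w, x} | x. x \<in> verts T - {u, v} \<and> adj T u x \<noteq> adj T v x}
        \<union> {{w, x} | x. x \<in> verts T - {u, v} \<and> adj T u x \<and> adj T v x
              \<and> \<not> ({u, x} \<in> black T \<and> {v, x} \<in> black T)} \<rparr>"

text \<open>
  The contracted vertex \<open>w\<close> only has to differ from the remaining vertices. It may reuse the
  name \<open>u\<close> or \<open>v\<close>, so that contractions exist over every vertex type, finite ones included;
  the choice of name changes the result only up to isomorphism.
\<close>

definition contraction_step :: "'a trigraph \<Rightarrow> 'a trigraph \<Rightarrow> bool" where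
  "contraction_step T T' \<longleftrightarrow>
     (\<exists>u v w. u \<in> verts T \<and> v \<in> verts T \<and> u \<noteq> v \<and> w \<notin> verts T - {u, v} \<and>
        T' = contract u v w T)"

definition red_degree :: "'a trigraph \<Rightarrow> 'a \<Rightarrow> nat" where
  "red_degree T x = card {e \<in> red T. x \<in> e}"

definition contraction_sequence :: "nat \<Rightarrow> 'a trigraph \<Rightarrow> (nat \<Rightarrow> 'a trigraph) \<Rightarrow> bool" where
  "contraction_sequence d T G \<longleftrightarrow>
     G (card (verts T)) = T \<and>
     (\<forall>i \<in> {1..<card (verts T)}. contraction_step (G (Suc i)) (G i)) \<and>
     (\<forall>i \<in> {1..card (verts T)}. \<forall>x \<in> verts (G i). red_degree (G i) x \<le> d)"

definition tww :: "'a trigraph \<Rightarrow> nat" where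
  "tww T = (LEAST d. \<exists>G. contraction_sequence d T G)"

definition king_graph :: "nat \<Rightarrow> nat \<Rightarrow> (nat \<times> nat) trigraph" where
  "king_graph n m =
    \<lparr> verts = {1..n} \<times> {1..m},
      black = {{(i, j), (i', j')} | i j i' j'.
         (i, j) \<in> {1..n} \<times> {1..m} \<and> (i', j') \<in> {1..n} \<times> {1..m} \<and> (i, j) \<noteq> (i', j') \<and>
         \<bar>int i - int i'\<bar> \<le> 1 \<and> \<bar>int j - int j'\<bar> \<le> 1},
      red = {} \<rparr>"

lemma trigraph_king_graph: "trigraph (king_graph n m)"
  unfolding trigraph_def king_graph_def by auto

lemma card_contract:
  assumes "finite (verts T)" "u \<in> verts T" "v \<in> verts T" "u \<noteq> v" "w \<notin> verts T - {u, v}"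
  shows "Suc (card (verts (contract u v w T))) = card (verts T)"
proof -
  have "card (verts T - {u, v}) = card (verts T) - 2"
    using assms by (simp add: card_Diff_subset)
  moreover have "card {u, v} \<le> card (verts T)"
    using assms by (intro card_mono) auto
  ultimately show ?thesis
    using assms by (simp add: contract_def card_insert_if)
qed

lemma trigraph_contract:
  assumes T: "trigraph T" and uv: "u \<in> verts T" "v \<in> verts T" "u \<noteq> v"
    and w: "w \<notin> verts T - {u, v}"
  shows "trigraph (contract u v w T)"
proof -
  have fin: "finite (verts T)" and dis: "black T \<inter> red T = {}"
    and edge: "\<And>e. e \<in> black T \<union> red T \<Longrightarrow> \<exists>x y. e = {x, y} \<and> x \<in> verts T \<and> y \<in> verts T \<and> x \<noteq> y"
    using T unfolding trigraph_def by auto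
  have old: "w \<notin> e" if "e \<in> black T \<union> red T" "u \<notin> e" "v \<notin> e" for e
    using edge[OF that(1)] that(2,3) w by auto
  have new: "e \<in> {{x, y} | x y. x \<in> insert w (verts T - {u, v}) \<and>
      y \<in> insert w (verts T - {u, v}) \<and> x \<noteq> y}"
    if "e \<in> {e \<in> black T \<union> red T. u \<notin> e \<and> v \<notin> e} \<union> {{w, x} | x. x \<in> verts T - {u, v}}" for e
    using that
  proof
    assume "e \<in> {e \<in> black T \<union> red T. u \<notin> e \<and> v \<notin> e}"
    then have e: "e \<in> black T \<union> red T" "u \<notin> e" "v \<notin> e" by auto
    show ?thesis using edge[OF e(1)] e(2,3) by blast
  next
    assume "e \<in> {{w, x} | x. x \<in> verts T - {u, v}}"
    then show ?thesis using w by blast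
  qed
  have sub: "black (contract u v w T) \<union> red (contract u v w T) \<subseteq>
      {e \<in> black T \<union> red T. u \<notin> e \<and> v \<notin> e} \<union> {{w, x} | x. x \<in> verts T - {u, v}}"
    by (auto simp: contract_def)
  have "False" if b: "e \<in> black (contract u v w T)" and r: "e \<in> red (contract u v w T)" for e
  proof (cases "w \<in> e")
    case False
    then show False using b r dis by (auto simp: contract_def)
  next
    case True
    have notold: "\<not> (e \<in> black T \<and> u \<notin> e \<and> v \<notin> e)" "\<not> (e \<in> red T \<and> u \<notin> e \<and> v \<notin> e)"
      using True old by blast+
    obtain x where x: "e = {w, x}" "x \<in> verts T - {u, v}" "{u, x} \<in> black T" "{v, x} \<in> black T"
      using b notold unfolding contract_def by simp blast
    obtain y where y: "e = {w, y}" "y \<in> verts T - {u, v}"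
        "\<not> ({u, y} \<in> black T \<and> {v, y} \<in> black T)"
      using r notold unfolding contract_def adj_def by simp blast
    have "x = y" using x y w by (metis doubleton_eq_iff)
    then show False using x y by simp
  qed
  then have "black (contract u v w T) \<inter> red (contract u v w T) = {}" by blast
  moreover have "verts (contract u v w T) = insert w (verts T - {u, v})"
    by (simp add: contract_def)
  ultimately show ?thesis
    using subset_trans[OF sub subsetI[OF new]] fin unfolding trigraph_def by simp
qed

text \<open>The set of admissible \<open>d\<close> is nonempty, so the minimum in the definition of twin-width is attained.\<close>

lemma contraction_sequence_exists:
  assumes "finite (verts T)"
  shows "\<exists>d G. contraction_sequence d T G"
proof -
  have "\<exists>G. G (card (verts T)) = T \<and>
      (\<forall>i \<in> {1..<card (verts T)}. contraction_step (G (Suc i)) (G i))"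
    using assms
  proof (induction "card (verts T)" arbitrary: T)
    case 0
    then show ?case by auto
  next
    case (Suc k)
    show ?case
    proof (cases "k = 0")
      case True
      then show ?thesis using Suc.hyps(2) by (intro exI[of _ "\<lambda>_. T"]) auto
    next
      case False
      then have "\<not> is_singleton (verts T)" "verts T \<noteq> {}"
        using Suc.hyps(2) by (auto simp: is_singleton_altdef)
      then obtain u v where uv: "u \<in> verts T" "v \<in> verts T" "u \<noteq> v"
        by (metis is_singletonI')
      let ?T = "contract u v u T"
      have k: "k = card (verts ?T)"
        using card_contract[OF Suc.prems uv, of u] Suc.hyps(2) by simp
      moreover have "finite (verts ?T)" using Suc.prems by (simp add: contract_def)
      ultimately obtain G where G: "G k = ?T"
          "\<forall>i \<in> {1..<k}. contraction_step (G (Suc i)) (G i)"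
        using Suc.hyps(1) by blast
      have "contraction_step T ?T" using uv unfolding contraction_step_def by blast
      then show ?thesis
        using G Suc.hyps(2)[symmetric]
        by (intro exI[of _ "G(Suc k := T)"]) (auto simp: less_Suc_eq)
    qed
  qed
  then obtain G where G: "G (card (verts T)) = T"
      "\<forall>i \<in> {1..<card (verts T)}. contraction_step (G (Suc i)) (G i)" by blast
  have fin: "finite (verts (G i))" if "i \<in> {1..card (verts T)}" for i
  proof -
    have "i \<le> card (verts T)" using that by simp
    then show ?thesis using that
    proof (induction rule: inc_induct)
      case base
      then show ?case using G(1) assms by simp
    next
      case (step j)
      then have "contraction_step (G (Suc j)) (G j)" "finite (verts (G (Suc j)))"
        using G(2) by auto
      then show ?case by (auto simp: contraction_step_def contract_def)
    qed
  qed
  let ?R = "\<Union>i \<in> {1..card (verts T)}. red_degree (G i) ` verts (G i)"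
  have "finite ?R" using fin by auto
  then have "contraction_sequence (Max ?R) T G"
    using G unfolding contraction_sequence_def by (auto intro!: Max_ge)
  then show ?thesis by blast
qed

lemma tww_attained:
  assumes "finite (verts T)"
  shows "\<exists>G. contraction_sequence (tww T) T G"
  unfolding tww_def using contraction_sequence_exists[OF assms] by (rule LeastI_ex)

end

theory Submission
  imports Defs
begin

text \<open>
  Merge the leftmost remaining column into the next one, row by row, and finally merge the last
  column into a single vertex. Whenever a vertex \<open>u\<close> is merged into \<open>v\<close>, all remaining neighbours
  of \<open>u\<close> are neighbours of \<open>v\<close>; so if the merged vertex keeps the name \<open>v\<close>, the underlying graph
  is always the induced King's graph on the remaining vertices, and every red edge has an
  end in the leftmost column or in the merged part of the next one. Counting neighbours then gives
  red degree at most 6.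
\<close>

text \<open>Reduces a whole sequence to one local step. By induction on the number of vertices, the
  sequence of the contracted trigraph is extended by \<open>T\<close> itself; since each contraction
  removes exactly one vertex, \<open>T\<close> belongs at index \<open>Suc k\<close>.\<close>

lemma contraction_sequence_if_invariant:
  assumes "Inv T"
    and fin: "\<And>T. Inv T \<Longrightarrow> finite (verts T)"
    and deg: "\<And>T x. Inv T \<Longrightarrow> x \<in> verts T \<Longrightarrow> red_degree T x \<le> d"
    and step: "\<And>T. Inv T \<Longrightarrow> card (verts T) \<ge> 2 \<Longrightarrow> \<exists>T'. contraction_step T T' \<and> Inv T'"
  shows "\<exists>G. contraction_sequence d T G"
  using assms(1)
proof (induction "card (verts T)" arbitrary: T)
  case 0
  then show ?case
    by (intro exI[of _ "\<lambda>_. T"]) (simp add: contraction_sequence_def)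
next
  case (Suc k)
  show ?case
  proof (cases "k = 0")
    case True
    then show ?thesis
      using Suc deg by (intro exI[of _ "\<lambda>_. T"]) (auto simp: contraction_sequence_def)
  next
    case False
    then obtain T' where T': "contraction_step T T'" "Inv T'"
      using step[OF Suc.prems] Suc.hyps(2) by auto
    then have k: "k = card (verts T')"
      using card_contract fin[OF Suc.prems] Suc.hyps(2)
      unfolding contraction_step_def by (metis Suc_inject)
    then obtain G where "contraction_sequence d T' G"
      using Suc.hyps(1) T'(2) by blast
    then have "contraction_sequence d T (G(Suc k := T))"
      using T' k Suc.hyps(2)[symmetric] deg[OF Suc.prems]
      by (auto simp: contraction_sequence_def less_Suc_eq le_Suc_eq)
    then show ?thesis by blast
  qed
qed

lemma tww_le:
  assumes "contraction_sequence d T G"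
  shows "tww T \<le> d"
  unfolding tww_def using assms by (intro Least_le) blast

lemma trigraph_edgeE:
  assumes "trigraph T" and "e \<in> black T \<union> red T"
  obtains x y where "e = {x, y}" "x \<in> verts T" "y \<in> verts T" "x \<noteq> y"
  using assms unfolding trigraph_def by blast

text \<open>The new vertex sees the union of both neighbourhoods, which here is the neighbourhood of
  \<open>v\<close>, apart from \<open>u\<close> and \<open>v\<close> themselves. Only colours
  change.\<close>

lemma adj_contract_into_dominating:
  assumes T: "trigraph T" and uv: "u \<in> verts T" "v \<in> verts T" "u \<noteq> v"
    and dom: "\<And>x. adj T u x \<Longrightarrow> x \<noteq> v \<Longrightarrow> adj T v x"
    and xy: "x \<in> verts T - {u}" "y \<in> verts T - {u}"
  shows "adj (contract u v v T) x y \<longleftrightarrow> adj T x y"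
proof -
  have loop: "\<not> adj T z z" for z
    using T by (auto simp: adj_def elim!: trigraph_edgeE[of T "{z}"])
  have sym: "adj T a b \<longleftrightarrow> adj T b a" for a b
    by (simp add: adj_def insert_commute)
  have new: "adj (contract u v v T) a b \<longleftrightarrow>
      {a, b} \<in> black T \<union> red T \<and> u \<notin> {a, b} \<and> v \<notin> {a, b} \<or>
      (\<exists>z. {a, b} = {v, z} \<and> z \<in> verts T - {u, v} \<and> (adj T u z \<or> adj T v z))" for a b
    unfolding adj_def contract_def by auto
  consider "x = v" "y = v" | "x = v" "y \<noteq> v" | "x \<noteq> v" "y = v" | "x \<noteq> v" "y \<noteq> v" by blast
  then show ?thesis
  proof cases
    case 1
    then show ?thesis unfolding new using loop by auto
  next
    case 2
    then show ?thesis unfolding new using xy uv dom by (auto simp: doubleton_eq_iff)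
  next
    case 3
    then show ?thesis unfolding new using xy uv dom sym by (auto simp: doubleton_eq_iff)
  next
    case 4
    then show ?thesis unfolding new using xy by (auto simp: doubleton_eq_iff adj_def)
  qed
qed

lemma red_contract_cases:
  assumes "e \<in> red (contract u v w T)"
  shows "e \<in> red T \<and> u \<notin> e \<and> v \<notin> e \<or> w \<in> e"
  using assms by (auto simp: contract_def)

definition king_adj :: "nat \<times> nat \<Rightarrow> nat \<times> nat \<Rightarrow> bool" where
  "king_adj x y \<longleftrightarrow> x \<noteq> y \<and> \<bar>int (fst x) - int (fst y)\<bar> \<le> 1 \<and> \<bar>int (snd x) - int (snd y)\<bar> \<le> 1"

lemma king_adj_iff:
  "king_adj (a, b) (c, d) \<longleftrightarrow>
     (a, b) \<noteq> (c, d) \<and> a \<le> Suc c \<and> c \<le> Suc a \<and> b \<le> Suc d \<and> d \<le> Suc b"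
  unfolding king_adj_def by auto

lemma adj_king_graph:
  assumes "x \<in> verts (king_graph n m)" "y \<in> verts (king_graph n m)"
  shows "adj (king_graph n m) x y \<longleftrightarrow> king_adj x y"
proof -
  obtain a b c d where "x = (a, b)" "y = (c, d)" by fastforce
  then show ?thesis
    using assms unfolding adj_def king_graph_def king_adj_def
    by (auto simp: doubleton_eq_iff)
qed

text \<open>The state in which columns \<open>< j\<close> and the first \<open>i\<close> vertices of column \<open>j\<close> have been merged away.\<close>

definition king_rest :: "nat \<Rightarrow> nat \<Rightarrow> nat \<Rightarrow> nat \<Rightarrow> (nat \<times> nat) set" where
  "king_rest n m i j = {(a, b). a \<in> {1..n} \<and> b \<in> {j..m} \<and> (b = j \<longrightarrow> i < a)}"

text \<open>All of column \<open>j\<close> is included because it is exactly the merged part of the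
  previous stage, once the column before it is used up.\<close>

definition king_merged :: "nat \<Rightarrow> nat \<Rightarrow> (nat \<times> nat) set" where
  "king_merged i j = {(a, b). b = j \<or> b = Suc j \<and> a \<le> i}"

text \<open>The strict \<open>i < n\<close> keeps \<open>(i + 1, j)\<close> available for the next
  contraction; an exhausted column is represented by \<open>i = 0\<close> in the next one.\<close>

definition king_state :: "nat \<Rightarrow> nat \<Rightarrow> nat \<Rightarrow> nat \<Rightarrow> (nat \<times> nat) trigraph \<Rightarrow> bool" where
  "king_state n m i j T \<longleftrightarrow>
     trigraph T \<and> 1 \<le> j \<and> j \<le> m \<and> i < n \<and> verts T = king_rest n m i j \<and>
     (\<forall>x \<in> verts T. \<forall>y \<in> verts T. adj T x y \<longleftrightarrow> king_adj x y) \<and>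
     (\<forall>e \<in> red T. e \<inter> king_merged i j \<noteq> {})"

lemma king_state_king_graph:
  assumes "n \<ge> 1" "m \<ge> 1"
  shows "king_state n m 0 1 (king_graph n m)"
  using assms trigraph_king_graph adj_king_graph
  by (auto simp: king_state_def king_rest_def king_graph_def)

lemma red_degree_le_card:
  assumes T: "trigraph T" and F: "finite F"
    and nb: "\<And>y. {x, y} \<in> red T \<Longrightarrow> y \<in> verts T \<Longrightarrow> y \<in> F"
  shows "red_degree T x \<le> card F"
proof -
  have "{e \<in> red T. x \<in> e} \<subseteq> (\<lambda>y. {x, y}) ` F"
  proof
    fix e assume e: "e \<in> {e \<in> red T. x \<in> e}"
    then obtain a b where "e = {a, b}" "a \<in> verts T" "b \<in> verts T"
      using trigraph_edgeE[OF T] by blast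
    then obtain y where "e = {x, y}" "y \<in> verts T"
      using e by (auto simp: insert_commute)
    then show "e \<in> (\<lambda>y. {x, y}) ` F" using nb e by blast
  qed
  then show ?thesis
    unfolding red_degree_def by (rule surj_card_le[OF F])
qed

lemma king_state_red_degree:
  assumes S: "king_state n m i j T" and x: "x \<in> verts T"
  shows "red_degree T x \<le> 6"
proof -
  obtain a b where ab: "x = (a, b)" by fastforce
  have T: "trigraph T" and V: "verts T = king_rest n m i j"
    using S by (auto simp: king_state_def)
  have red: "king_adj x y \<and> (x \<in> king_merged i j \<or> y \<in> king_merged i j)"
    if "{x, y} \<in> red T" "y \<in> verts T" for y
  proof -
    have "adj T x y" using that by (simp add: adj_def)
    moreover have "{x, y} \<inter> king_merged i j \<noteq> {}"
      using S that(1) unfolding king_state_def by blast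
    ultimately show ?thesis using S x that by (auto simp: king_state_def)
  qed
  \<comment> \<open>Candidates for red neighbours in three cases: \<open>x\<close> in the leftmost
    column, in the merged part of the next one, or elsewhere. Points of \<open>F\<close> outside the
    grid do no harm to an upper bound.\<close>
  define F where "F =
    (if b = j then {(a-1, j), (a+1, j), (a-1, j+1), (a, j+1), (a+1, j+1)}
     else if b = j + 1 \<and> a \<le> i
       then {(a-1, b), (a+1, b), (a-1, b+1), (a, b+1), (a+1, b+1), (i+1, j)}
     else {(a-1, b-1), (a, b-1), (a+1, b-1), (a-1, b)})"
  have "y \<in> F" if "{x, y} \<in> red T" "y \<in> verts T" for y
  proof -
    obtain c d where cd: "y = (c, d)" by fastforce
    have low: "b \<ge> j" "d \<ge> j" "d = j \<longrightarrow> i < c"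
      using x that V ab cd by (auto simp: king_rest_def)
    have near: "(a, b) \<noteq> (c, d)" "c = a - 1 \<or> c = a \<or> c = a + 1" "d = b - 1 \<or> d = b \<or> d = b + 1"
      "c \<le> Suc a"
      using red[OF that] ab cd by (auto simp: king_adj_iff)
    have merged: "b = j \<or> b = j + 1 \<and> a \<le> i \<or> d = j \<or> d = j + 1 \<and> c \<le> i"
      using red[OF that] ab cd by (auto simp: king_merged_def)
    consider "b = j" | "b = j + 1" "a \<le> i" | "b > j" "\<not> (b = j + 1 \<and> a \<le> i)"
      using low(1) by linarith
    then show ?thesis
    proof cases
      case 1
      then have "d = j \<or> d = j + 1" using near(3) low(2) by linarith
      then show ?thesis using 1 near(1,2) by (auto simp: F_def cd)
    next
      case 2
      \<comment> \<open>Column \<open>j\<close> only retains rows above \<open>i\<close>, while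
        \<open>c \<le> a + 1 \<le> i + 1\<close>; so it contributes one neighbour instead of
        three.\<close>
      have "c = i + 1" if "d = j" using that 2 low(3) near(4) by linarith
      then show ?thesis using 2 near(1-3) by (auto simp: F_def cd)
    next
      case 3
      \<comment> \<open>Now \<open>y\<close> must be the merged end. If it shares the column of
        \<open>x\<close>, that column is \<open>j + 1\<close> and
        \<open>c \<le> i < a\<close>.\<close>
      then have "d = b - 1 \<or> d = b \<and> c = a - 1" using merged near(2,3) by (elim disjE) auto
      then show ?thesis using 3 near(2) by (auto simp: F_def cd)
    qed
  qed
  moreover have "finite F" by (simp add: F_def)
  moreover have "card F \<le> 6"
    by (simp add: F_def card_insert_if)
  ultimately show ?thesis
    using red_degree_le_card[OF T] by (meson le_trans)
qed

lemma king_state_step: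
  assumes S: "king_state n m i j T" and two: "card (verts T) \<ge> 2"
  shows "\<exists>T' i' j'. contraction_step T T' \<and> king_state n m i' j' T'"
proof -
  have T: "trigraph T" and V: "verts T = king_rest n m i j"
    and ij: "1 \<le> j" "j \<le> m" "i < n"
    and adj: "\<And>x y. x \<in> verts T \<Longrightarrow> y \<in> verts T \<Longrightarrow> adj T x y \<longleftrightarrow> king_adj x y"
    and red: "\<And>e. e \<in> red T \<Longrightarrow> e \<inter> king_merged i j \<noteq> {}"
    using S by (auto simp: king_state_def)
  have last: "j < m \<or> i + 1 < n"
  proof (rule ccontr)
    assume "\<not> ?thesis"
    then have "m = j" "n = Suc i" using ij by simp_all
    then have "verts T = {(n, m)}"
      using ij(1) unfolding V king_rest_def by fastforce
    then show False using two by simp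
  qed
  define u where "u = (i + 1, j)"
  \<comment> \<open>The right neighbour of \<open>u\<close>, or the next row when only the last
    column is left; \<open>last\<close> ensures that it exists.\<close>
  define v where "v = (if j < m then (i + 1, j + 1) else (i + 2, j))"
  define T' where "T' = contract u v v T"
  define i' where "i' = (if i + 1 < n then i + 1 else 0)"
  define j' where "j' = (if i + 1 < n then j else j + 1)"
  have uv: "u \<in> verts T" "v \<in> verts T" "u \<noteq> v"
    using ij last V by (auto simp: u_def v_def king_rest_def)
  have nb: "x \<in> verts T" if "adj T u x" for x
    using that trigraph_edgeE[OF T, of "{u, x}"] unfolding adj_def
    by (metis doubleton_eq_iff)
  \<comment> \<open>Nothing remains in earlier columns or in earlier rows of column
    \<open>j\<close>. So the neighbours of \<open>u\<close> lie in rows \<open>i\<close> to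
    \<open>i + 2\<close> of column \<open>j + 1\<close> or equal \<open>(i + 2, j)\<close>; in the
    last column \<open>v\<close> is the only one.\<close>
  have dom: "adj T v x" if "adj T u x" "x \<noteq> v" for x
  proof -
    have "king_adj u x" using that adj nb uv by blast
    then have "king_adj v x"
      using nb[OF that(1)] that(2) ij unfolding V
      by (cases x) (auto simp: u_def v_def king_adj_iff king_rest_def split: if_splits)
    then show ?thesis using adj nb uv that by blast
  qed
  have V': "verts T' = verts T - {u}"
    using uv by (auto simp: T'_def contract_def)
  have rest: "verts T' = king_rest n m i' j'"
    unfolding V' V using ij by (auto simp: u_def i'_def j'_def king_rest_def)
  have T': "trigraph T'"
    unfolding T'_def using trigraph_contract[OF T uv] by blast
  \<comment> \<open>A red edge is old, with an end already in the merged set, or new and contains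
    \<open>v\<close>. Surviving vertices of the old merged set stay in the new one, and
    \<open>v\<close> joins it.\<close>
  have "e \<inter> king_merged i' j' \<noteq> {}" if e: "e \<in> red T'" for e
  proof -
    have "e \<subseteq> verts T'" using e trigraph_edgeE[OF T', of e] by blast
    moreover have "e \<inter> insert v (king_merged i j) \<noteq> {}"
      using red_contract_cases[OF e[unfolded T'_def]] red by blast
    ultimately obtain z where z: "z \<in> e" "z \<in> king_rest n m i' j'" "z \<in> insert v (king_merged i j)"
      using rest by blast
    then have "z \<in> king_merged i' j'"
      using last ij
      by (cases z) (auto simp: king_rest_def king_merged_def i'_def j'_def v_def split: if_splits)
    then show ?thesis using z by blast
  qed
  moreover have "adj T' x y \<longleftrightarrow> king_adj x y" if "x \<in> verts T'" "y \<in> verts T'" for x y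
    using adj_contract_into_dominating[OF T uv dom] that adj
    unfolding T'_def[symmetric] V' by blast
  ultimately have "king_state n m i' j' T'"
    using T' rest ij last by (auto simp: king_state_def i'_def j'_def)
  moreover have "contraction_step T T'"
    unfolding contraction_step_def T'_def using uv by blast
  ultimately show ?thesis by blast
qed

lemma tww_king_graph_le_6:
  assumes "n \<ge> 1" and "m \<ge> 1"
  shows "tww (king_graph n m) \<le> 6"
proof -
  have "\<exists>G. contraction_sequence 6 (king_graph n m) G"
  proof (rule contraction_sequence_if_invariant[where Inv = "\<lambda>T. \<exists>i j. king_state n m i j T"])
    show "\<exists>i j. king_state n m i j (king_graph n m)"
      using king_state_king_graph[OF assms] by blast
    show "finite (verts T)" if "\<exists>i j. king_state n m i j T" for T
      using that by (auto simp: king_state_def trigraph_def)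
    show "red_degree T x \<le> 6" if "\<exists>i j. king_state n m i j T" "x \<in> verts T" for T x
      using that king_state_red_degree by blast
    show "\<exists>T'. contraction_step T T' \<and> (\<exists>i j. king_state n m i j T')"
      if "\<exists>i j. king_state n m i j T" "2 \<le> card (verts T)" for T
      using that king_state_step by blast
  qed
  then show ?thesis using tww_le by blast
qed

theorem theorem1p5:
  fixes n m :: nat
  assumes "n \<ge> 1" and "m \<ge> 1"
  shows "tww (king_graph n m) \<le> 7"
  using tww_king_graph_le_6[OF assms] by simp

end
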